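(* Let $L$ be an MV-algebra and $a\in B(L)$. Then the MV-algebra $L$ is isomorphic to the direct product of the MV-algebras $(Fix_{d_{a^\ast}}(L),\oplus,\neg_2,0,a^\ast)$ and $(Fix_{g_{a^\ast}}(L),\oplus,\circ_2,a^\ast,1)$.
   Context: An MV-algebra is an algebra $(L,\oplus,{}^\ast,0)$ of type $(2,1,0)$ such that $(L,\oplus,0)$ is a commutative monoid, $(x^\ast)^\ast=x$, $0^\ast\oplus x=0^\ast$, and $(x^\ast\oplus y)^\ast\oplus y=(y^\ast\oplus x)^\ast\oplus x$ for all $x,y\in L$. Put $1=0^\ast$, $x\odot y=(x^\ast\oplus y^\ast)^\ast$, $x\ominus y=x\odot y^\ast$, $x\rightarrow y=x^\ast\oplus y$. The Boolean center is $B(L)=\{a\in L\mid a\oplus a=a\}$. For $a\in L$ define maps $L\to L$ by $d_{a^\ast}(x)=x\ominus a=x\odot a^\ast$ and $g_{a^\ast}(x)=a\rightarrow x=a^\ast\oplus x$. For a map $f:L\to L$, $Fix_f(L)=\{x\in L\mid f(x)=x\}$. For $a\in B(L)$: $(Fix_{d_{a^\ast}}(L),\oplus,\neg_2,0,a^\ast)$ is the MV-algebra with the addition $\oplus$ of $L$, negation $\neg_2x=d_{a^\ast}(x^\ast)$, zero element $0$ and unit (top) $a^\ast$; $(Fix_{g_{a^\ast}}(L),\oplus,\circ_2,a^\ast,1)$ is the MV-algebra with the addition $\oplus$ of $L$, negation $x^{\circ_2}=g_{a^\ast}(x^\ast)$, zero element $a^\ast$ and unit (top) $1$. *)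

theory Defs
  imports "HOL-Algebra.Group"
begin

record 'a mv = "'a partial_object" +
  mv_add :: "['a, 'a] \<Rightarrow> 'a" (infixl \<open>\<oplus>\<index>\<close> 65)
  mv_neg :: "'a \<Rightarrow> 'a" (\<open>_\<^sup>\<star>\<index>\<close> [1000] 999)
  mv_zero :: 'a (\<open>\<zero>\<index>\<close>)

abbreviation mv_add_monoid :: "('a, 'm) mv_scheme \<Rightarrow> 'a monoid" where
  "mv_add_monoid L \<equiv> \<lparr>carrier = carrier L, mult = mv_add L, one = mv_zero L\<rparr>"

locale mv_algebra =
  fixes L :: "('a, 'm) mv_scheme" (structure)
  assumes add_comm_monoid: "comm_monoid (mv_add_monoid L)"
    and neg_closed: "x \<in> carrier L \<Longrightarrow> x\<^sup>\<star> \<in> carrier L"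
    and neg_neg: "x \<in> carrier L \<Longrightarrow> (x\<^sup>\<star>)\<^sup>\<star> = x"
    and neg_zero_add: "x \<in> carrier L \<Longrightarrow> \<zero>\<^sup>\<star> \<oplus> x = \<zero>\<^sup>\<star>"
    and lukasiewicz: "\<lbrakk>x \<in> carrier L; y \<in> carrier L\<rbrakk> \<Longrightarrow>
      (x\<^sup>\<star> \<oplus> y)\<^sup>\<star> \<oplus> y = (y\<^sup>\<star> \<oplus> x)\<^sup>\<star> \<oplus> x"

definition mv_one :: "('a, 'm) mv_scheme \<Rightarrow> 'a" where
  "mv_one L = mv_neg L (mv_zero L)"

definition mv_mult :: "('a, 'm) mv_scheme \<Rightarrow> 'a \<Rightarrow> 'a \<Rightarrow> 'a" (infixl \<open>\<odot>\<index>\<close> 70) where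
  "x \<odot>\<^bsub>L\<^esub> y = (x\<^sup>\<star>\<^bsub>L\<^esub> \<oplus>\<^bsub>L\<^esub> y\<^sup>\<star>\<^bsub>L\<^esub>)\<^sup>\<star>\<^bsub>L\<^esub>"

definition mv_diff :: "('a, 'm) mv_scheme \<Rightarrow> 'a \<Rightarrow> 'a \<Rightarrow> 'a" (infixl \<open>\<ominus>\<index>\<close> 65) where
  "x \<ominus>\<^bsub>L\<^esub> y = x \<odot>\<^bsub>L\<^esub> y\<^sup>\<star>\<^bsub>L\<^esub>"

definition mv_imp :: "('a, 'm) mv_scheme \<Rightarrow> 'a \<Rightarrow> 'a \<Rightarrow> 'a" (infixr \<open>\<rightharpoonup>\<index>\<close> 60) where
  "x \<rightharpoonup>\<^bsub>L\<^esub> y = x\<^sup>\<star>\<^bsub>L\<^esub> \<oplus>\<^bsub>L\<^esub> y"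

definition boolean_center :: "('a, 'm) mv_scheme \<Rightarrow> 'a set" where
  "boolean_center L = {a \<in> carrier L. a \<oplus>\<^bsub>L\<^esub> a = a}"

text \<open>The parameter of \<open>mv_d\<close> and \<open>mv_g\<close> is \<open>a\<close> itself: \<open>mv_d L a\<close> and \<open>mv_g L a\<close> are the maps
  usually written with the subscript \<open>a\<^sup>\<star>\<close>.\<close>

definition mv_d :: "('a, 'm) mv_scheme \<Rightarrow> 'a \<Rightarrow> 'a \<Rightarrow> 'a" where
  "mv_d L a x = x \<ominus>\<^bsub>L\<^esub> a"

definition mv_g :: "('a, 'm) mv_scheme \<Rightarrow> 'a \<Rightarrow> 'a \<Rightarrow> 'a" where
  "mv_g L a x = a \<rightharpoonup>\<^bsub>L\<^esub> x"

definition Fix :: "('a, 'm) mv_scheme \<Rightarrow> ('a \<Rightarrow> 'a) \<Rightarrow> 'a set" where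
  "Fix L f = {x \<in> carrier L. f x = x}"

definition Fix_d_alg :: "('a, 'm) mv_scheme \<Rightarrow> 'a \<Rightarrow> 'a mv" where
  "Fix_d_alg L a =
    \<lparr>carrier = Fix L (mv_d L a),
     mv_add = mv_add L,
     mv_neg = (\<lambda>x. mv_d L a (x\<^sup>\<star>\<^bsub>L\<^esub>)),
     mv_zero = \<zero>\<^bsub>L\<^esub>\<rparr>"

definition Fix_g_alg :: "('a, 'm) mv_scheme \<Rightarrow> 'a \<Rightarrow> 'a mv" where
  "Fix_g_alg L a =
    \<lparr>carrier = Fix L (mv_g L a),
     mv_add = mv_add L,
     mv_neg = (\<lambda>x. mv_g L a (x\<^sup>\<star>\<^bsub>L\<^esub>)),
     mv_zero = a\<^sup>\<star>\<^bsub>L\<^esub>\<rparr>"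

definition mv_prod :: "('a, 'm) mv_scheme \<Rightarrow> ('b, 'n) mv_scheme \<Rightarrow> ('a \<times> 'b) mv"
    (infixr \<open>\<times>\<^sub>M\<^sub>V\<close> 80) where
  "A \<times>\<^sub>M\<^sub>V B =
    \<lparr>carrier = carrier A \<times> carrier B,
     mv_add = (\<lambda>(x, y) (x', y'). (x \<oplus>\<^bsub>A\<^esub> x', y \<oplus>\<^bsub>B\<^esub> y')),
     mv_neg = (\<lambda>(x, y). (x\<^sup>\<star>\<^bsub>A\<^esub>, y\<^sup>\<star>\<^bsub>B\<^esub>)),
     mv_zero = (\<zero>\<^bsub>A\<^esub>, \<zero>\<^bsub>B\<^esub>)\<rparr>"

definition mv_hom :: "('a, 'm) mv_scheme \<Rightarrow> ('b, 'n) mv_scheme \<Rightarrow> ('a \<Rightarrow> 'b) set" where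
  "mv_hom A B =
    {h \<in> carrier A \<rightarrow> carrier B.
      (\<forall>x\<in>carrier A. \<forall>y\<in>carrier A. h (x \<oplus>\<^bsub>A\<^esub> y) = h x \<oplus>\<^bsub>B\<^esub> h y) \<and>
      (\<forall>x\<in>carrier A. h (x\<^sup>\<star>\<^bsub>A\<^esub>) = (h x)\<^sup>\<star>\<^bsub>B\<^esub>) \<and>
      h \<zero>\<^bsub>A\<^esub> = \<zero>\<^bsub>B\<^esub>}"

definition mv_iso :: "('a, 'm) mv_scheme \<Rightarrow> ('b, 'n) mv_scheme \<Rightarrow> ('a \<Rightarrow> 'b) set" where
  "mv_iso A B = {h \<in> mv_hom A B. bij_betw h (carrier A) (carrier B)}"

definition mv_isomorphic :: "('a, 'm) mv_scheme \<Rightarrow> ('b, 'n) mv_scheme \<Rightarrow> bool"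
    (infix \<open>\<cong>\<^sub>M\<^sub>V\<close> 50) where
  "A \<cong>\<^sub>M\<^sub>V B \<longleftrightarrow> mv_iso A B \<noteq> {}"

end

theory Submission
  imports Defs
begin

text \<open>For \<open>a\<close> in the Boolean center, \<open>b = a\<^sup>\<star>\<close> is again Boolean, and the identity
  \<open>a \<oplus> (a \<oplus> z\<^sup>\<star>)\<^sup>\<star> = a \<oplus> z\<close> for Boolean \<open>a\<close> (that is, \<open>a \<or> z = a \<oplus> z\<close>) shows that
  \<open>x \<mapsto> x \<odot> b\<close> and \<open>x \<mapsto> b \<oplus> x\<close> are homomorphisms of \<open>L\<close> onto the two algebras of fixed points;
  homomorphic images of MV-algebras are MV-algebras. The combined map into the product is injective because
  \<open>e \<odot> b = b\<close> and \<open>b \<oplus> e = 1\<close> force \<open>e = 1\<close>, which is applied to \<open>e = x\<^sup>\<star> \<oplus> y\<close>; it is onto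
  because \<open>u \<oplus> (v \<odot> a)\<close> is sent to \<open>(u, v)\<close>.\<close>

lemma mv_homD:
  assumes "h \<in> mv_hom A B"
  shows "\<lbrakk>x \<in> carrier A; y \<in> carrier A\<rbrakk> \<Longrightarrow> h (x \<oplus>\<^bsub>A\<^esub> y) = h x \<oplus>\<^bsub>B\<^esub> h y"
    and "x \<in> carrier A \<Longrightarrow> h (x\<^sup>\<star>\<^bsub>A\<^esub>) = (h x)\<^sup>\<star>\<^bsub>B\<^esub>"
    and "h \<zero>\<^bsub>A\<^esub> = \<zero>\<^bsub>B\<^esub>"
  using assms by (auto simp: mv_hom_def)

context mv_algebra
begin

section \<open>Sums, complements and order in an MV-algebra\<close>

lemma add_closed [simp]: "\<lbrakk>x \<in> carrier L; y \<in> carrier L\<rbrakk> \<Longrightarrow> x \<oplus> y \<in> carrier L"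
  using comm_monoid.axioms(1)[OF add_comm_monoid, THEN monoid.m_closed] by simp

lemma zero_closed [simp]: "\<zero> \<in> carrier L"
  using comm_monoid.axioms(1)[OF add_comm_monoid, THEN monoid.one_closed] by simp

lemma add_assoc:
  "\<lbrakk>x \<in> carrier L; y \<in> carrier L; z \<in> carrier L\<rbrakk> \<Longrightarrow> (x \<oplus> y) \<oplus> z = x \<oplus> (y \<oplus> z)"
  using comm_monoid.axioms(1)[OF add_comm_monoid, THEN monoid.m_assoc] by simp

lemma add_comm: "\<lbrakk>x \<in> carrier L; y \<in> carrier L\<rbrakk> \<Longrightarrow> x \<oplus> y = y \<oplus> x"
  using comm_monoid.m_comm[OF add_comm_monoid] by simp

lemma add_left_comm:
  "\<lbrakk>x \<in> carrier L; y \<in> carrier L; z \<in> carrier L\<rbrakk> \<Longrightarrow> x \<oplus> (y \<oplus> z) = y \<oplus> (x \<oplus> z)"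
  using comm_monoid.m_lcomm[OF add_comm_monoid] by simp

lemmas add_ac = add_assoc add_comm add_left_comm

lemma zero_add [simp]: "x \<in> carrier L \<Longrightarrow> \<zero> \<oplus> x = x"
  using comm_monoid.axioms(1)[OF add_comm_monoid, THEN monoid.l_one] by simp

lemma add_zero [simp]: "x \<in> carrier L \<Longrightarrow> x \<oplus> \<zero> = x"
  using comm_monoid.axioms(1)[OF add_comm_monoid, THEN monoid.r_one] by simp

declare neg_closed [simp] neg_neg [simp] neg_zero_add [simp]

lemma add_neg_zero [simp]: "x \<in> carrier L \<Longrightarrow> x \<oplus> \<zero>\<^sup>\<star> = \<zero>\<^sup>\<star>"
  by (metis add_comm neg_closed neg_zero_add zero_closed)

text \<open>Setting \<open>y = 1\<close> in \<open>lukasiewicz\<close> makes the left side 1 and the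
  right side the sum in question.\<close>

lemma neg_add [simp]: "x \<in> carrier L \<Longrightarrow> x\<^sup>\<star> \<oplus> x = \<zero>\<^sup>\<star>"
  using lukasiewicz[of x "\<zero>\<^sup>\<star>"] by simp

lemma add_neg [simp]: "x \<in> carrier L \<Longrightarrow> x \<oplus> x\<^sup>\<star> = \<zero>\<^sup>\<star>"
  by (simp add: add_comm[of x "x\<^sup>\<star>"])

lemma add_neg_left [simp]:
  "\<lbrakk>x \<in> carrier L; y \<in> carrier L\<rbrakk> \<Longrightarrow> x \<oplus> (x\<^sup>\<star> \<oplus> y) = \<zero>\<^sup>\<star>"
  "\<lbrakk>x \<in> carrier L; y \<in> carrier L\<rbrakk> \<Longrightarrow> x\<^sup>\<star> \<oplus> (x \<oplus> y) = \<zero>\<^sup>\<star>"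
  by (simp_all flip: add_assoc)

text \<open>The hypotheses mean x \<le> y and y \<le> x; they reduce the two sides of
  \<open>lukasiewicz\<close> to y and x.\<close>

lemma antisym:
  assumes "x \<in> carrier L" "y \<in> carrier L" "x\<^sup>\<star> \<oplus> y = \<zero>\<^sup>\<star>" "y\<^sup>\<star> \<oplus> x = \<zero>\<^sup>\<star>"
  shows "x = y"
  using lukasiewicz[of x y] assms by simp

section \<open>Boolean elements\<close>

lemma boolean_centerD:
  assumes "b \<in> boolean_center L"
  shows "b \<in> carrier L" and "b \<oplus> b = b"
  using assms by (auto simp: boolean_center_def)

lemma boolean_add_left:
  assumes "b \<in> boolean_center L" "x \<in> carrier L"
  shows "b \<oplus> (b \<oplus> x) = b \<oplus> x"
  using assms by (simp add: boolean_centerD flip: add_assoc)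

lemma boolean_center_neg:
  assumes "b \<in> boolean_center L"
  shows "b\<^sup>\<star> \<in> boolean_center L"
proof -
  note b = boolean_centerD[OF assms]
  \<comment> \<open>Idempotence of b turns the other side of this instance into
    \<open>b\<^sup>\<star> \<oplus> b\<close>, which is 1.\<close>
  have "(b\<^sup>\<star> \<oplus> b\<^sup>\<star>)\<^sup>\<star> \<oplus> b\<^sup>\<star> = \<zero>\<^sup>\<star>"
    using lukasiewicz[of b "b\<^sup>\<star>"] b by simp
  then have "b\<^sup>\<star> \<oplus> b\<^sup>\<star> = b\<^sup>\<star>"
    using b antisym[of "b\<^sup>\<star> \<oplus> b\<^sup>\<star>" "b\<^sup>\<star>"] by simp
  with b show ?thesis by (simp add: boolean_center_def)
qed

text \<open>The left side is the join of b and z, hence at most b \<oplus> z. Adding b to the join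
  changes nothing, by idempotence, and this gives the reverse inequality.\<close>

lemma boolean_absorb:
  assumes "b \<in> boolean_center L" and z: "z \<in> carrier L"
  shows "b \<oplus> (b \<oplus> z\<^sup>\<star>)\<^sup>\<star> = b \<oplus> z"
proof -
  note b = boolean_centerD[OF assms(1)]
  \<comment> \<open>\<open>t\<close>, \<open>r\<close> and \<open>s\<close> are the differences z
    \<ominus> b, z \<ominus> t and b \<ominus> z.\<close>
  define t where "t = (b \<oplus> z\<^sup>\<star>)\<^sup>\<star>"
  define r where "r = (z\<^sup>\<star> \<oplus> t)\<^sup>\<star>"
  define s where "s = (b\<^sup>\<star> \<oplus> z)\<^sup>\<star>"
  have cl: "t \<in> carrier L" "r \<in> carrier L" "s \<in> carrier L"
    using b z by (simp_all add: t_def r_def s_def)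
  have zt: "z = t \<oplus> r"
  proof -
    have "t\<^sup>\<star> \<oplus> z = \<zero>\<^sup>\<star>" using b z by (simp add: t_def add_assoc)
    then show ?thesis using lukasiewicz[of z t] cl z by (simp add: r_def add_comm)
  qed
  have bt: "b \<oplus> t = z \<oplus> s"
    using lukasiewicz[of z b] b z by (simp add: t_def s_def add_comm)
  have up: "(b \<oplus> t) \<oplus> r = b \<oplus> z" using zt b cl by (simp add: add_assoc)
  have down: "(b \<oplus> z) \<oplus> s = b \<oplus> t"
    using bt boolean_add_left[OF assms(1), of t] b z cl by (simp add: add_assoc)
  have "(b \<oplus> t)\<^sup>\<star> \<oplus> (b \<oplus> z) = \<zero>\<^sup>\<star>"
    unfolding up[symmetric] using b cl by (intro add_neg_left) auto
  moreover have "(b \<oplus> z)\<^sup>\<star> \<oplus> (b \<oplus> t) = \<zero>\<^sup>\<star>"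
    unfolding down[symmetric] using b cl z by (intro add_neg_left) auto
  ultimately have "b \<oplus> t = b \<oplus> z"
    using b cl z antisym[of "b \<oplus> t" "b \<oplus> z"] by simp
  then show ?thesis by (simp add: t_def)
qed

lemma boolean_absorb':
  assumes "b \<in> boolean_center L" and z: "z \<in> carrier L"
  shows "b \<oplus> (b \<oplus> z)\<^sup>\<star> = b \<oplus> z\<^sup>\<star>"
  using boolean_absorb[OF assms(1), of "z\<^sup>\<star>"] z by simp

text \<open>This is absorption for \<open>b\<^sup>\<star>\<close> at the argument b \<oplus> z,
  whose sum with \<open>b\<^sup>\<star>\<close> is 1.\<close>

lemma neg_boolean_absorb:
  assumes "b \<in> boolean_center L" and z: "z \<in> carrier L"
  shows "b\<^sup>\<star> \<oplus> (b \<oplus> z)\<^sup>\<star> = b\<^sup>\<star>"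
  using boolean_absorb'[OF boolean_center_neg[OF assms(1)], of "b \<oplus> z"] assms boolean_centerD
  by simp

text \<open>The hypothesis \<open>le\<close> puts x below \<open>b\<^sup>\<star>\<close>, hence b
  below \<open>x\<^sup>\<star>\<close>. Their join is then \<open>x\<^sup>\<star>\<close>, and a
  join with a Boolean element is a sum.\<close>

lemma boolean_add_neg_eq:
  assumes "b \<in> boolean_center L" and x: "x \<in> carrier L" and le: "b\<^sup>\<star> \<oplus> x = b\<^sup>\<star>"
  shows "b \<oplus> x\<^sup>\<star> = x\<^sup>\<star>"
proof -
  note b = boolean_centerD[OF assms(1)]
  have "b\<^sup>\<star> \<oplus> x\<^sup>\<star> = \<zero>\<^sup>\<star>"
    using add_assoc[of "b\<^sup>\<star>" x "x\<^sup>\<star>"] b x le by simp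
  then have "b \<oplus> (b \<oplus> x)\<^sup>\<star> = x\<^sup>\<star>"
    using lukasiewicz[of "x\<^sup>\<star>" b] b x by (simp add: add_comm)
  then show ?thesis using boolean_absorb'[OF assms(1) x] by simp
qed

section \<open>Homomorphic images\<close>

lemma mv_algebra_image:
  fixes B :: "('b, 'n) mv_scheme"
  assumes h: "h \<in> mv_hom L B" and surj: "h ` carrier L = carrier B"
  shows "mv_algebra B"
proof -
  \<comment> \<open>Read from right to left, the homomorphism equations collapse every term over
    \<open>B\<close> to \<open>h\<close> of a term over \<open>L\<close>, so each axiom is
    inherited.\<close>
  note h_eq = mv_homD[OF h, symmetric]
  show ?thesis
  proof (rule mv_algebra.intro)
    show "comm_monoid (mv_add_monoid B)"
      by (rule comm_monoidI) (auto simp: surj[symmetric] h_eq add_ac)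
    fix x y
    assume "x \<in> carrier B" "y \<in> carrier B"
    then obtain x' y' where "x = h x'" "y = h y'" "x' \<in> carrier L" "y' \<in> carrier L"
      using surj by blast
    then show "(x\<^sup>\<star>\<^bsub>B\<^esub> \<oplus>\<^bsub>B\<^esub> y)\<^sup>\<star>\<^bsub>B\<^esub> \<oplus>\<^bsub>B\<^esub> y = (y\<^sup>\<star>\<^bsub>B\<^esub> \<oplus>\<^bsub>B\<^esub> x)\<^sup>\<star>\<^bsub>B\<^esub> \<oplus>\<^bsub>B\<^esub> x"
      using arg_cong[OF lukasiewicz[of x' y'], of h] by (simp add: h_eq)
  qed (auto simp: surj[symmetric] h_eq)
qed

section \<open>The two maps onto their fixed points\<close>

lemma mv_d_eq: "\<lbrakk>a \<in> carrier L; x \<in> carrier L\<rbrakk> \<Longrightarrow> mv_d L a x = (a \<oplus> x\<^sup>\<star>)\<^sup>\<star>"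
  by (simp add: mv_d_def mv_diff_def mv_mult_def add_comm)

lemma mv_g_eq: "mv_g L a x = a\<^sup>\<star> \<oplus> x"
  by (simp add: mv_g_def mv_imp_def)

context
  fixes a
  assumes a: "a \<in> boolean_center L"
begin

lemma center_closed [simp]: "a \<in> carrier L"
  using boolean_centerD[OF a] by simp

lemma neg_center: "a\<^sup>\<star> \<in> boolean_center L"
  by (rule boolean_center_neg[OF a])

lemma mv_d_closed [simp]: "x \<in> carrier L \<Longrightarrow> mv_d L a x \<in> carrier L"
  by (simp add: mv_d_eq)

lemma mv_g_closed [simp]: "x \<in> carrier L \<Longrightarrow> mv_g L a x \<in> carrier L"
  by (simp add: mv_g_eq)

text \<open>Together with \<open>mv_d_add_center\<close> this shows that \<open>mv_d L a x\<close>
  and a \<oplus> x determine each other.\<close>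

lemma add_mv_d: "x \<in> carrier L \<Longrightarrow> a \<oplus> mv_d L a x = a \<oplus> x"
  by (simp add: mv_d_eq boolean_absorb[OF a])

lemma mv_d_add_center: "x \<in> carrier L \<Longrightarrow> mv_d L a (a \<oplus> x) = mv_d L a x"
  by (simp add: mv_d_eq boolean_absorb'[OF a])

lemma neg_add_mv_d: "x \<in> carrier L \<Longrightarrow> a\<^sup>\<star> \<oplus> mv_d L a x = a\<^sup>\<star>"
  by (simp add: mv_d_eq neg_boolean_absorb[OF a])

text \<open>With \<open>neg_add_mv_d\<close>, this characterizes the fixed points as the elements
  below \<open>a\<^sup>\<star>\<close>, by an equation that sums visibly preserve.\<close>

lemma mv_d_fixed: "\<lbrakk>x \<in> carrier L; a\<^sup>\<star> \<oplus> x = a\<^sup>\<star>\<rbrakk> \<Longrightarrow> mv_d L a x = x"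
  by (simp add: mv_d_eq boolean_add_neg_eq[OF a])

lemma mv_d_idem: "x \<in> carrier L \<Longrightarrow> mv_d L a (mv_d L a x) = mv_d L a x"
  by (simp add: mv_d_fixed neg_add_mv_d)

lemma mv_d_add:
  assumes "x \<in> carrier L" "y \<in> carrier L"
  shows "mv_d L a (x \<oplus> y) = mv_d L a x \<oplus> mv_d L a y"
proof -
  let ?u = "mv_d L a x \<oplus> mv_d L a y"
  have u: "?u \<in> carrier L" using assms by simp
  have "a\<^sup>\<star> \<oplus> ?u = a\<^sup>\<star>"
    using assms by (simp add: neg_add_mv_d flip: add_assoc)
  then have "?u = mv_d L a ?u" using u by (simp add: mv_d_fixed)
  also have "\<dots> = mv_d L a (a \<oplus> ?u)" using u by (simp add: mv_d_add_center)
  also have "a \<oplus> ?u = (a \<oplus> mv_d L a x) \<oplus> mv_d L a y"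
    using assms by (simp add: add_assoc)
  also have "\<dots> = x \<oplus> (a \<oplus> mv_d L a y)"
    unfolding add_mv_d[OF assms(1)] using assms by (simp add: add_ac)
  also have "\<dots> = a \<oplus> (x \<oplus> y)"
    unfolding add_mv_d[OF assms(2)] using assms by (simp add: add_left_comm)
  also have "mv_d L a \<dots> = mv_d L a (x \<oplus> y)"
    using assms by (simp add: mv_d_add_center)
  finally show ?thesis ..
qed

text \<open>The left side is the complement of a \<oplus> x, which does not change when x is
  replaced by \<open>mv_d L a x\<close>. The right side is the negation of
  \<open>Fix_d_alg\<close>.\<close>

lemma mv_d_neg: "x \<in> carrier L \<Longrightarrow> mv_d L a (x\<^sup>\<star>) = mv_d L a ((mv_d L a x)\<^sup>\<star>)"
  using add_mv_d[of x] by (simp add: mv_d_eq)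

lemma mv_d_hom: "mv_d L a \<in> mv_hom L (Fix_d_alg L a)"
  by (auto simp: mv_hom_def Fix_d_alg_def Fix_def mv_d_idem mv_d_add simp flip: mv_d_neg)
    (simp add: mv_d_eq)

lemma mv_g_idem: "x \<in> carrier L \<Longrightarrow> mv_g L a (mv_g L a x) = mv_g L a x"
  by (simp add: mv_g_eq boolean_add_left[OF neg_center])

lemma mv_g_add:
  assumes "x \<in> carrier L" "y \<in> carrier L"
  shows "mv_g L a (x \<oplus> y) = mv_g L a x \<oplus> mv_g L a y"
  using assms add_left_comm[of x "a\<^sup>\<star>" y]
  by (simp add: mv_g_eq add_assoc boolean_add_left[OF neg_center])

lemma mv_g_neg: "x \<in> carrier L \<Longrightarrow> mv_g L a (x\<^sup>\<star>) = mv_g L a ((mv_g L a x)\<^sup>\<star>)"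
  by (simp add: mv_g_eq boolean_absorb'[OF neg_center])

lemma mv_g_hom: "mv_g L a \<in> mv_hom L (Fix_g_alg L a)"
  by (auto simp: mv_hom_def Fix_g_alg_def Fix_def mv_g_idem mv_g_add simp flip: mv_g_neg)
    (simp_all add: mv_g_eq)

lemma Fix_d_alg_mv_algebra: "mv_algebra (Fix_d_alg L a)"
proof (rule mv_algebra_image[OF mv_d_hom])
  show "mv_d L a ` carrier L = carrier (Fix_d_alg L a)"
    \<comment> \<open>Every fixed point is its own preimage.\<close>
    by (force simp: Fix_d_alg_def Fix_def mv_d_idem)
qed

lemma Fix_g_alg_mv_algebra: "mv_algebra (Fix_g_alg L a)"
proof (rule mv_algebra_image[OF mv_g_hom])
  show "mv_g L a ` carrier L = carrier (Fix_g_alg L a)"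
    by (force simp: Fix_g_alg_def Fix_def mv_g_idem)
qed

section \<open>Bijectivity of the combined map\<close>

lemma eq_one_if_mv_d_mv_g:
  assumes e: "e \<in> carrier L" and d: "mv_d L a e = a\<^sup>\<star>" and g: "mv_g L a e = \<zero>\<^sup>\<star>"
  shows "e = \<zero>\<^sup>\<star>"
proof -
  have "a \<oplus> e\<^sup>\<star> = a"
    using d e by (metis mv_d_eq neg_neg add_closed neg_closed center_closed)
  then have "a\<^sup>\<star> \<oplus> e = e"
    using boolean_add_neg_eq[OF neg_center, of "e\<^sup>\<star>"] e by simp
  with g show ?thesis by (simp add: mv_g_eq)
qed

text \<open>Both maps send \<open>x\<^sup>\<star> \<oplus> y\<close> to the same value as
  \<open>x\<^sup>\<star> \<oplus> x\<close>, which is 1.\<close>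

lemma le_if_mv_d_mv_g:
  assumes "x \<in> carrier L" "y \<in> carrier L" "mv_d L a x = mv_d L a y" "mv_g L a x = mv_g L a y"
  shows "x\<^sup>\<star> \<oplus> y = \<zero>\<^sup>\<star>"
proof (rule eq_one_if_mv_d_mv_g)
  have "mv_d L a (x\<^sup>\<star> \<oplus> y) = mv_d L a (x\<^sup>\<star> \<oplus> x)"
    using assms by (simp only: mv_d_add neg_closed)
  then show "mv_d L a (x\<^sup>\<star> \<oplus> y) = a\<^sup>\<star>"
    using assms by (simp add: mv_d_eq)
  have "mv_g L a (x\<^sup>\<star> \<oplus> y) = x\<^sup>\<star> \<oplus> mv_g L a y"
    using assms by (simp add: mv_g_eq add_left_comm)
  also have "\<dots> = x\<^sup>\<star> \<oplus> mv_g L a x"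
    using assms by simp
  finally show "mv_g L a (x\<^sup>\<star> \<oplus> y) = \<zero>\<^sup>\<star>"
    using assms by (simp add: mv_g_eq add_left_comm)
qed (use assms in simp)

lemma mv_d_mv_g_inj: "inj_on (\<lambda>x. (mv_d L a x, mv_g L a x)) (carrier L)"
  by (rule inj_onI, rule antisym) (auto intro: le_if_mv_d_mv_g)

lemma mv_d_mv_g_surj:
  assumes "u \<in> Fix L (mv_d L a)" "v \<in> Fix L (mv_g L a)"
  obtains x where "x \<in> carrier L" "mv_d L a x = u" "mv_g L a x = v"
proof
  \<comment> \<open>This is v \<odot> a, the part of v below a: \<open>mv_d\<close> sends it to 0,
    and adding \<open>a\<^sup>\<star>\<close> restores v.\<close>
  let ?w = "(a\<^sup>\<star> \<oplus> v\<^sup>\<star>)\<^sup>\<star>"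
  have u: "u \<in> carrier L" "mv_d L a u = u" and v: "v \<in> carrier L" "a\<^sup>\<star> \<oplus> v = v"
    using assms by (auto simp: Fix_def mv_g_eq)
  show "u \<oplus> ?w \<in> carrier L" using u v by simp
  have "mv_d L a ?w = \<zero>" using v by (simp add: mv_d_eq)
  then show "mv_d L a (u \<oplus> ?w) = u" using u v by (simp add: mv_d_add)
  have "mv_g L a (u \<oplus> ?w) = u \<oplus> (a\<^sup>\<star> \<oplus> ?w)" using u v by (simp add: mv_g_eq add_left_comm)
  also have "\<dots> = u \<oplus> (a\<^sup>\<star> \<oplus> v)" using v by (simp add: boolean_absorb[OF neg_center])
  also have "\<dots> = (a\<^sup>\<star> \<oplus> u) \<oplus> v" using u(1) v(1) by (simp add: add_ac)
  \<comment> \<open>As a fixed point of \<open>mv_d\<close>, u lies below the Boolean element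
    \<open>a\<^sup>\<star>\<close> and is absorbed.\<close>
  also have "a\<^sup>\<star> \<oplus> u = a\<^sup>\<star>" using neg_add_mv_d[of u] u by simp
  finally show "mv_g L a (u \<oplus> ?w) = v" using v by simp
qed

lemma mv_d_mv_g_iso:
  "(\<lambda>x. (mv_d L a x, mv_g L a x)) \<in> mv_iso L (Fix_d_alg L a \<times>\<^sub>M\<^sub>V Fix_g_alg L a)"
proof -
  have "(\<lambda>x. (mv_d L a x, mv_g L a x)) \<in> mv_hom L (Fix_d_alg L a \<times>\<^sub>M\<^sub>V Fix_g_alg L a)"
    using mv_d_hom mv_g_hom by (auto simp: mv_hom_def mv_prod_def)
  moreover have "(\<lambda>x. (mv_d L a x, mv_g L a x)) ` carrier L =
      Fix L (mv_d L a) \<times> Fix L (mv_g L a)"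
  proof
    show "(\<lambda>x. (mv_d L a x, mv_g L a x)) ` carrier L \<subseteq> Fix L (mv_d L a) \<times> Fix L (mv_g L a)"
      by (auto simp: Fix_def mv_d_idem mv_g_idem)
    show "Fix L (mv_d L a) \<times> Fix L (mv_g L a) \<subseteq> (\<lambda>x. (mv_d L a x, mv_g L a x)) ` carrier L"
    proof clarify
      fix u v
      assume "u \<in> Fix L (mv_d L a)" "v \<in> Fix L (mv_g L a)"
      then obtain x where "x \<in> carrier L" "mv_d L a x = u" "mv_g L a x = v"
        by (rule mv_d_mv_g_surj)
      then show "(u, v) \<in> (\<lambda>x. (mv_d L a x, mv_g L a x)) ` carrier L"
        by blast
    qed
  qed
  ultimately show ?thesis
    using mv_d_mv_g_inj
    by (simp add: mv_iso_def bij_betw_def mv_prod_def Fix_d_alg_def Fix_g_alg_def)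
qed

end

end

theorem theorem4p19:
  fixes L :: "('a, 'm) mv_scheme" (structure) and a :: 'a
  assumes "mv_algebra L" and "a \<in> boolean_center L"
  shows "mv_algebra (Fix_d_alg L a) \<and> mv_one (Fix_d_alg L a) = a\<^sup>\<star> \<and>
    mv_algebra (Fix_g_alg L a) \<and> mv_one (Fix_g_alg L a) = mv_one L \<and>
    L \<cong>\<^sub>M\<^sub>V Fix_d_alg L a \<times>\<^sub>M\<^sub>V Fix_g_alg L a"
proof -
  interpret mv_algebra L by fact
  note a = boolean_centerD(1)[OF assms(2)]
  \<comment> \<open>The unit is the negation of the factor applied to its zero: here
    \<open>1 \<ominus> a\<close>, and \<open>a\<^sup>\<star> \<oplus> a\<close> for the second
    factor.\<close>
  have "mv_one (Fix_d_alg L a) = a\<^sup>\<star>"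
    using a by (simp add: mv_one_def Fix_d_alg_def mv_d_eq)
  moreover have "mv_one (Fix_g_alg L a) = mv_one L"
    using a by (simp add: mv_one_def Fix_g_alg_def mv_g_eq)
  moreover have "L \<cong>\<^sub>M\<^sub>V Fix_d_alg L a \<times>\<^sub>M\<^sub>V Fix_g_alg L a"
    using mv_d_mv_g_iso[OF assms(2)] by (auto simp: mv_isomorphic_def)
  ultimately show ?thesis
    using Fix_d_alg_mv_algebra[OF assms(2)] Fix_g_alg_mv_algebra[OF assms(2)] by simp
qed

end
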